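(* Let $t\ge 2$ and $d\ge 3$ be integers, and let $\mathcal{F}\subset 2^{[n]}$ be a $d$-wise $t$-intersecting family. Then, for $0<p<\beta_{t,d}$, $$\mu_p(\mathcal{F})\le p^t.$$
   Context: Notation: $[n]=\{1,\dots,n\}$. A family $\mathcal{F}\subseteq 2^{[n]}$ is $d$-wise $t$-intersecting if $|F_1\cap\cdots\cap F_d|\ge t$ for all $F_1,\dots,F_d\in\mathcal{F}$. For $0<p<1$ and $F\in 2^{[n]}$, $\mu_p(F)=p^{|F|}(1-p)^{n-|F|}$, and for a family $\mathcal{F}\subset 2^{[n]}$, $\mu_p(\mathcal{F})=\sum_{F\in\mathcal{F}}\mu_p(F)$. For integers $t\ge 2$ and $d\ge 3$, let $f_{t,d}(x)=(1-x)^{t+d-3}-x^{d-2}$, and let $\beta_{t,d}\in(0,\frac12)$ denote the root of $f_{t,d}$ in this interval, i.e. $(1-\beta_{t,d})^{t+d-3}-\beta_{t,d}^{d-2}=0$. *)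

theory Defs
  imports Complex_Main
begin

text \<open>The members \<open>F 1, \<dots>, F d\<close> need not be distinct. The notion is only meant for
  \<open>d \<ge> 1\<close> and families of finite sets, where \<open>card\<close> is the true cardinality of the intersection.\<close>

definition wise_intersecting :: "nat \<Rightarrow> nat \<Rightarrow> 'a set set \<Rightarrow> bool" where
  "wise_intersecting d t \<F> \<longleftrightarrow>
     (\<forall>F :: nat \<Rightarrow> 'a set. (\<forall>i\<in>{1..d}. F i \<in> \<F>) \<longrightarrow> t \<le> card (\<Inter>i\<in>{1..d}. F i))"

definition mu_set :: "nat \<Rightarrow> real \<Rightarrow> nat set \<Rightarrow> real" where
  "mu_set n p F = p ^ card F * (1 - p) ^ (n - card F)"

definition mu :: "nat \<Rightarrow> real \<Rightarrow> nat set set \<Rightarrow> real" where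
  "mu n p \<F> = (\<Sum>F\<in>\<F>. mu_set n p F)"

text \<open>For \<open>t \<ge> 2\<close> and \<open>d \<ge> 3\<close> the natural-number subtractions in the exponents do not truncate.\<close>

definition f_poly :: "nat \<Rightarrow> nat \<Rightarrow> real \<Rightarrow> real" where
  "f_poly t d x = (1 - x) ^ (t + d - 3) - x ^ (d - 2)"

definition beta :: "nat \<Rightarrow> nat \<Rightarrow> real" where
  "beta t d = (THE x. 0 < x \<and> x < 1/2 \<and> f_poly t d x = 0)"

lemma f_poly_root_unique:
  assumes "t \<ge> 2" and "d \<ge> 3"
  shows "\<exists>!x. 0 < x \<and> x < 1/2 \<and> f_poly t d x = 0"
proof -
  have anti: "f_poly t d y < f_poly t d x" if "0 < x" "x < y" "y < 1/2" for x y
  proof -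
    have "(1 - y) ^ (t + d - 3) < (1 - x) ^ (t + d - 3)"
      using that assms by (intro power_strict_mono) auto
    moreover have "x ^ (d - 2) < y ^ (d - 2)"
      using that assms by (intro power_strict_mono) auto
    ultimately show ?thesis by (simp add: f_poly_def)
  qed
  have "(1/2 :: real) ^ (t + d - 3) < (1/2) ^ (d - 2)"
    using assms by (intro power_strict_decreasing) auto
  then have half: "f_poly t d (1/2) < 0" by (simp add: f_poly_def)
  have zero: "f_poly t d 0 = 1" using assms by (simp add: f_poly_def)
  have cont: "isCont (f_poly t d) x" for x
    unfolding f_poly_def by (intro continuous_intros)
  have "\<exists>x\<ge>0. x \<le> 1/2 \<and> f_poly t d x = 0"
    using half zero IVT2[of "f_poly t d" "1/2" 0 0] cont by auto
  then obtain x where x: "0 \<le> x" "x \<le> 1/2" "f_poly t d x = 0" by blast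
  have "x \<noteq> 0" "x \<noteq> 1/2" using x half zero by (metis less_irrefl zero_neq_one)+
  with x have root: "0 < x \<and> x < 1/2 \<and> f_poly t d x = 0" by auto
  moreover have "y = x" if "0 < y \<and> y < 1/2 \<and> f_poly t d y = 0" for y
    using anti[of x y] anti[of y x] that root by (cases x y rule: linorder_cases) auto
  ultimately show ?thesis by blast
qed

lemma beta_root:
  assumes "t \<ge> 2" and "d \<ge> 3"
  shows "0 < beta t d" and "beta t d < 1/2" and "f_poly t d (beta t d) = 0"
  using theI'[OF f_poly_root_unique[OF assms]] by (auto simp: beta_def)

end

theory Submission
  imports Defs
begin

text \<open>Suppose that \<open>d\<close>-wise intersections have at least \<open>t\<close> elements. If some \<open>d - 1\<close> members meet
  in exactly \<open>t\<close> elements, then every member contains these \<open>t\<close> elements, and the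
  measure is at most \<open>p ^ t\<close>. Otherwise the family is \<open>(d - 1)\<close>-wise \<open>(t + 1)\<close>-intersecting, and
  the same alternative applies again. Iterating, either the family lies in a star over a core of
  at least \<open>t\<close> elements, or it is pairwise \<open>s\<close>-intersecting with \<open>s = t + d - 2\<close>
  (lemma \<open>wise_intersecting_star_or_pairwise\<close>).

  In the second case the bound
  \[ \mu_p(\mathcal{F}) \le p \Bigl(\frac{p}{1-p}\Bigr)^{s-1} \]
  holds for every pairwise \<open>s\<close>-intersecting family and \<open>p \<le> 1/2\<close> (lemma
  \<open>mu_pairwise_intersecting\<close>), and its right-hand side is at most \<open>p ^ t\<close> exactly when
  \<open>p ^ (d - 2) \<le> (1 - p) ^ (t + d - 3)\<close>, which is the meaning of \<open>p \<le> \<beta>\<close>.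

  The bound reflects a random walk which goes up with probability \<open>p\<close> and down with probability
  \<open>1 - p\<close>, and which ever climbs \<open>s - 1\<close> levels with probability at most \<open>(p / (1 - p)) ^ (s - 1)\<close>.
  After shifting towards a point \<open>a\<close>, the members containing \<open>a\<close> form, with \<open>a\<close> removed, an
  \<open>(s - 1)\<close>-intersecting family, while those avoiding \<open>a\<close> form an \<open>(s + 1)\<close>-intersecting one; the
  bound for \<open>s\<close> is exactly the weighted mean of the bounds for \<open>s - 1\<close> and \<open>s + 1\<close>, so induction on
  the ground set works for \<open>s \<ge> 2\<close>. The boundary case \<open>s = 1\<close> is the classical bound
  \<open>p\<close> for intersecting families. It follows from the
  case \<open>p = 1/2\<close>, where complementary pairs decide, because for an up-set the measure at \<open>p\<close> is
  controlled by a power of the measure at \<open>1/2\<close> (lemma \<open>mu_upset_le_powr\<close>).\<close>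

section \<open>The product measure and its decomposition at a point\<close>

lemma mu_set_nonneg: "0 \<le> p \<Longrightarrow> p \<le> 1 \<Longrightarrow> 0 \<le> mu_set n p F"
  by (simp add: mu_set_def)

lemma mu_nonneg: "0 \<le> p \<Longrightarrow> p \<le> 1 \<Longrightarrow> 0 \<le> mu n p G"
  by (simp add: mu_def mu_set_nonneg sum_nonneg)

lemma mu_mono:
  assumes "0 \<le> p" "p \<le> 1" "finite H" "G \<subseteq> H"
  shows "mu n p G \<le> mu n p H"
  unfolding mu_def using assms by (intro sum_mono2) (auto simp: mu_set_nonneg)

definition link :: "'a \<Rightarrow> 'a set set \<Rightarrow> 'a set set" where
  "link a G = {F. a \<notin> F \<and> insert a F \<in> G}"

definition deletion :: "'a \<Rightarrow> 'a set set \<Rightarrow> 'a set set" where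
  "deletion a G = {F \<in> G. a \<notin> F}"

lemma link_subset: "G \<subseteq> Pow (insert a X) \<Longrightarrow> link a G \<subseteq> Pow X"
  by (auto simp: link_def)

lemma deletion_subset: "G \<subseteq> Pow (insert a X) \<Longrightarrow> deletion a G \<subseteq> Pow X"
  by (auto simp: deletion_def)

lemma mu_split:
  assumes "finite X" "a \<notin> X" "G \<subseteq> Pow (insert a X)"
  shows "mu (card (insert a X)) p G
    = p * mu (card X) p (link a G) + (1 - p) * mu (card X) p (deletion a G)"
proof -
  let ?n = "card X"
  have n: "card (insert a X) = Suc ?n" using assms by simp
  have fG: "finite G" using assms by (meson finite_Pow_iff finite_insert finite_subset)
  have G: "G = insert a ` link a G \<union> deletion a G"
  proof
    show "G \<subseteq> insert a ` link a G \<union> deletion a G"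
    proof
      fix F assume F: "F \<in> G"
      show "F \<in> insert a ` link a G \<union> deletion a G"
      proof (cases "a \<in> F")
        case True
        then have "F = insert a (F - {a})" "F - {a} \<in> link a G"
          using F by (auto simp: link_def insert_absorb)
        then show ?thesis by blast
      qed (use F in \<open>simp add: deletion_def\<close>)
    qed
  qed (auto simp: link_def deletion_def)
  have fin: "finite (link a G)" "finite (deletion a G)"
    using link_subset[OF assms(3)] deletion_subset[OF assms(3)] assms(1)
    by (meson finite_Pow_iff finite_subset)+
  have inj: "inj_on (insert a) (link a G)"
    by (auto simp: inj_on_def link_def)
  have "mu (Suc ?n) p G
      = (\<Sum>F\<in>insert a ` link a G. mu_set (Suc ?n) p F) + (\<Sum>F\<in>deletion a G. mu_set (Suc ?n) p F)"
    unfolding mu_def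
    by (subst G, rule sum.union_disjoint) (use fin in \<open>auto simp: deletion_def\<close>)
  also have "(\<Sum>F\<in>insert a ` link a G. mu_set (Suc ?n) p F) = p * mu ?n p (link a G)"
    unfolding mu_def sum_distrib_left sum.reindex[OF inj] o_def
  proof (rule sum.cong[OF refl])
    fix F assume "F \<in> link a G"
    then have "finite F" "a \<notin> F"
      using link_subset[OF assms(3)] assms(1) by (auto simp: link_def intro: finite_subset)
    then show "mu_set (Suc ?n) p (insert a F) = p * mu_set ?n p F"
      by (simp add: mu_set_def)
  qed
  also have "(\<Sum>F\<in>deletion a G. mu_set (Suc ?n) p F) = (1 - p) * mu ?n p (deletion a G)"
    unfolding mu_def sum_distrib_left
  proof (rule sum.cong[OF refl])
    fix F assume "F \<in> deletion a G"
    then have "card F \<le> ?n"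
      using deletion_subset[OF assms(3)] assms(1) by (auto intro: card_mono)
    then show "mu_set (Suc ?n) p F = (1 - p) * mu_set ?n p F"
      by (simp add: mu_set_def Suc_diff_le)
  qed
  finally show ?thesis by (simp add: n)
qed

lemma mu_star_le:
  assumes "finite X" "G \<subseteq> Pow X" "0 \<le> p" "p \<le> 1" "\<And>F. F \<in> G \<Longrightarrow> T \<subseteq> F" "finite T"
  shows "mu (card X) p G \<le> p ^ card T"
  using assms
proof (induction X arbitrary: G T rule: finite_induct)
  case empty
  show ?case
  proof (cases "G = {}")
    case False
    then have "G = {{}}" "T = {}" using empty.prems by auto
    then show ?thesis by (simp add: mu_def mu_set_def)
  qed (use empty.prems in \<open>simp add: mu_def\<close>)
next
  case (insert a X)
  have l: "mu (card X) p (link a G) \<le> p ^ card (T - {a})"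
    by (rule insert.IH) (use insert.prems in \<open>auto simp: link_def\<close>)
  show ?case
  proof (cases "a \<in> T")
    case True
    then have "deletion a G = {}" using insert.prems by (auto simp: deletion_def)
    then have "mu (card (insert a X)) p G = p * mu (card X) p (link a G)"
      by (subst mu_split) (use insert in \<open>auto simp: mu_def\<close>)
    also have "\<dots> \<le> p * p ^ card (T - {a})" using l insert.prems by (intro mult_left_mono)
    also have "\<dots> = p ^ card T"
      using True insert.prems by (metis card_Suc_Diff1 power_Suc)
    finally show ?thesis .
  next
    case False
    have r: "mu (card X) p (deletion a G) \<le> p ^ card T"
      by (rule insert.IH) (use insert.prems in \<open>auto simp: deletion_def\<close>)
    have "mu (card (insert a X)) p G
        = p * mu (card X) p (link a G) + (1 - p) * mu (card X) p (deletion a G)"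
      by (rule mu_split) (use insert in auto)
    also have "\<dots> \<le> p * p ^ card T + (1 - p) * p ^ card T"
      using l r False insert.prems by (intro add_mono mult_left_mono) auto
    finally show ?thesis by (simp add: algebra_simps)
  qed
qed

section \<open>Intersecting families\<close>

definition pairwise_intersecting :: "nat \<Rightarrow> 'a set set \<Rightarrow> bool" where
  "pairwise_intersecting s G \<longleftrightarrow> (\<forall>A\<in>G. \<forall>B\<in>G. s \<le> card (A \<inter> B))"

text \<open>Multiplied by \<open>2 powr c\<close>, the inequality bounds \<open>(x + y) powr c - x powr c\<close> from below by its
  value at \<open>x = y\<close>. The bound holds because this increment does not decrease with \<open>x\<close>: the power
  function is convex for \<open>c \<ge> 1\<close>.\<close>

lemma two_point_powr:
  fixes x y c :: real
  assumes "0 \<le> y" "y \<le> x" "1 \<le> c"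
  defines "h \<equiv> (1/2) powr c"
  shows "h * x powr c + (1 - h) * y powr c \<le> (1/2 * x + 1/2 * y) powr c"
proof -
  have eq: "(1/2 * x + 1/2 * y) powr c = h * (x + y) powr c"
    unfolding h_def using assms by (subst powr_mult[symmetric]) (auto simp: field_simps)
  show ?thesis
  proof (cases "y = 0")
    case True
    then show ?thesis unfolding eq by simp
  next
    case False
    then have y: "y > 0" using assms by simp
    have "(y + y) powr c - y powr c \<le> (x + y) powr c - x powr c"
    proof (rule DERIV_nonneg_imp_nondecreasing[OF assms(2)])
      fix u assume u: "y \<le> u" "u \<le> x"
      have "((\<lambda>u. (u + y) powr c - u powr c) has_real_derivative
          c * (u + y) powr (c - 1) - c * u powr (c - 1)) (at u)"
        using u y by (auto intro!: derivative_eq_intros)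
      moreover have "0 \<le> c * (u + y) powr (c - 1) - c * u powr (c - 1)"
        using u y assms(3) by (simp add: mult_left_mono powr_mono2)
      ultimately show "\<exists>D. ((\<lambda>u. (u + y) powr c - u powr c) has_real_derivative D) (at u) \<and> 0 \<le> D"
        by blast
    qed
    moreover have hp: "0 \<le> h" unfolding h_def by simp
    ultimately have "h * ((y + y) powr c - y powr c) \<le> h * ((x + y) powr c - x powr c)"
      by (intro mult_left_mono)
    moreover have "h * (y + y) powr c = y powr c"
      unfolding h_def using y by (subst powr_mult[symmetric]) auto
    ultimately show ?thesis unfolding eq by (simp add: algebra_simps)
  qed
qed

text \<open>Equality holds for the up-set of all sets containing a given \<open>T\<close>. In an up-set
  the deletion at a point is contained in the link, which is the order of \<open>x\<close> and \<open>y\<close> that the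
  two-point inequality asks for.\<close>

lemma mu_upset_le_powr:
  fixes c :: real
  assumes "finite X" "G \<subseteq> Pow X" "\<And>A B. A \<in> G \<Longrightarrow> A \<subseteq> B \<Longrightarrow> B \<subseteq> X \<Longrightarrow> B \<in> G" "1 \<le> c"
  shows "mu (card X) ((1/2) powr c) G \<le> mu (card X) (1/2) G powr c"
  using assms
proof (induction X arbitrary: G rule: finite_induct)
  case empty
  then have "G = {} \<or> G = {{}}" by auto
  then show ?case by (auto simp: mu_def mu_set_def)
next
  case (insert a X)
  let ?n = "card X" and ?h = "(1/2) powr c :: real"
  have h: "0 \<le> ?h" "?h \<le> 1" using insert.prems by (auto simp: powr_le1)
  have up_link: "B \<in> link a G" if "A \<in> link a G" "A \<subseteq> B" "B \<subseteq> X" for A B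
    using that insert.prems(2)[of "insert a A" "insert a B"] insert.hyps by (auto simp: link_def)
  have up_deletion: "B \<in> deletion a G" if "A \<in> deletion a G" "A \<subseteq> B" "B \<subseteq> X" for A B
    using that insert.prems(2)[of A B] insert.hyps by (auto simp: deletion_def)
  have sub: "deletion a G \<subseteq> link a G"
    using insert.prems(1) insert.prems(2)[of F "insert a F" for F]
    by (fastforce simp: deletion_def link_def)
  have fin: "finite (link a G)"
    using link_subset[OF insert.prems(1)] insert.hyps by (meson finite_Pow_iff finite_subset)
  have "mu (card (insert a X)) ?h G
      = ?h * mu ?n ?h (link a G) + (1 - ?h) * mu ?n ?h (deletion a G)"
    by (rule mu_split) (use insert in auto)
  also have "\<dots> \<le> ?h * mu ?n (1/2) (link a G) powr c + (1 - ?h) * mu ?n (1/2) (deletion a G) powr c"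
    using insert.IH[OF link_subset[OF insert.prems(1)] up_link insert.prems(3)]
      insert.IH[OF deletion_subset[OF insert.prems(1)] up_deletion insert.prems(3)] h
    by (intro add_mono mult_left_mono) auto
  also have "\<dots> \<le> (1/2 * mu ?n (1/2) (link a G) + 1/2 * mu ?n (1/2) (deletion a G)) powr c"
    using fin sub insert.prems(3) by (intro two_point_powr mu_nonneg mu_mono) auto
  also have "1/2 * mu ?n (1/2) (link a G) + 1/2 * mu ?n (1/2) (deletion a G)
      = mu (card (insert a X)) (1/2) G"
    by (subst mu_split) (use insert in auto)
  finally show ?case .
qed

text \<open>Of two complementary sets at most one belongs to the family.\<close>

lemma mu_half_intersecting:
  assumes "finite X" "G \<subseteq> Pow X" "pairwise_intersecting 1 G"
  shows "mu (card X) (1/2) G \<le> 1/2"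
proof -
  let ?n = "card X" and ?C = "(\<lambda>F. X - F) ` G"
  have fG: "finite G" using assms by (meson finite_Pow_iff finite_subset)
  have "inj_on (\<lambda>F. X - F) G"
    using assms(2) by (auto simp: inj_on_def)
  then have "card ?C = card G" by (rule card_image)
  moreover have "G \<inter> ?C = {}"
  proof (rule ccontr)
    assume "G \<inter> ?C \<noteq> {}"
    then obtain F where "F \<in> G" "X - F \<in> G" by blast
    then have "1 \<le> card (F \<inter> (X - F))"
      using assms(3) unfolding pairwise_intersecting_def by blast
    then show False by (simp add: Diff_disjoint)
  qed
  ultimately have "card G + card G = card (G \<union> ?C)"
    using fG by (simp add: card_Un_disjoint)
  also have "\<dots> \<le> card (Pow X)"
    using assms by (intro card_mono) auto
  finally have "2 * card G \<le> 2 ^ ?n" using assms(1) by (simp add: card_Pow)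
  then have c: "2 * real (card G) \<le> 2 ^ ?n"
    by (metis of_nat_le_iff of_nat_mult of_nat_numeral of_nat_power)
  have "mu ?n (1/2) G = (\<Sum>F\<in>G. (1/2) ^ ?n)"
    unfolding mu_def
  proof (rule sum.cong[OF refl])
    fix F assume "F \<in> G"
    then have "card F \<le> ?n" using assms by (auto intro: card_mono)
    then show "mu_set ?n (1/2) F = (1/2) ^ ?n"
      by (simp add: mu_set_def flip: power_add)
  qed
  also have "\<dots> = real (card G) / 2 ^ ?n" by (simp add: power_divide)
  also have "\<dots> \<le> 1/2" using c by (simp add: field_simps)
  finally show ?thesis .
qed

text \<open>The up-closure of an intersecting family is intersecting. With \<open>c\<close> chosen so that
  \<open>(1/2) powr c = p\<close>, the bound \<open>1/2\<close> at \<open>1/2\<close> becomes the bound \<open>p\<close> at \<open>p\<close>.\<close>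

lemma mu_intersecting:
  assumes "finite X" "G \<subseteq> Pow X" "pairwise_intersecting 1 G" "0 < p" "p \<le> 1/2"
  shows "mu (card X) p G \<le> p"
proof -
  define U where "U = {B. B \<subseteq> X \<and> (\<exists>A\<in>G. A \<subseteq> B)}"
  define c where "c = log (1/2) p"
  have cp: "(1/2) powr c = p" unfolding c_def using assms by simp
  have c1: "1 \<le> c"
  proof (rule ccontr)
    assume "\<not> 1 \<le> c"
    then have "(1/2 :: real) powr 1 < (1/2) powr c"
      by (intro powr_less_mono') auto
    then show False using cp assms by simp
  qed
  have U: "U \<subseteq> Pow X" by (auto simp: U_def)
  then have fU: "finite U" using assms(1) by (meson finite_Pow_iff finite_subset)
  have up: "B \<in> U" if "A \<in> U" "A \<subseteq> B" "B \<subseteq> X" for A B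
    using that unfolding U_def by blast
  have intU: "pairwise_intersecting 1 U"
    unfolding pairwise_intersecting_def
  proof (intro ballI)
    fix B B' assume "B \<in> U" "B' \<in> U"
    then obtain A A' where A: "A \<in> G" "A' \<in> G" "A \<inter> A' \<subseteq> B \<inter> B'" and "B \<subseteq> X"
      unfolding U_def by blast
    then have "card (A \<inter> A') \<le> card (B \<inter> B')"
      using assms(1) by (intro card_mono) (auto intro: finite_subset)
    moreover have "1 \<le> card (A \<inter> A')"
      using A assms(3) unfolding pairwise_intersecting_def by blast
    ultimately show "1 \<le> card (B \<inter> B')" by linarith
  qed
  have "mu (card X) p G \<le> mu (card X) p U"
    using assms fU by (intro mu_mono) (auto simp: U_def)
  also have "\<dots> \<le> mu (card X) (1/2) U powr c"
    using mu_upset_le_powr[OF assms(1) U up c1] unfolding cp .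
  also have "\<dots> \<le> (1/2) powr c"
    using mu_half_intersecting[OF assms(1) U intU] c1 by (intro powr_mono2) (auto simp: mu_nonneg)
  finally show ?thesis by (simp add: cp)
qed

section \<open>Shifting towards a point\<close>

definition shift_set :: "'a \<Rightarrow> 'a \<Rightarrow> 'a set \<Rightarrow> 'a set" where
  "shift_set a x F = insert a (F - {x})"

definition movable :: "'a \<Rightarrow> 'a \<Rightarrow> 'a set set \<Rightarrow> 'a set set" where
  "movable a x G = {F \<in> G. x \<in> F \<and> a \<notin> F \<and> shift_set a x F \<notin> G}"

definition shift :: "'a \<Rightarrow> 'a \<Rightarrow> 'a set set \<Rightarrow> 'a set set" where
  "shift a x G = (G - movable a x G) \<union> shift_set a x ` movable a x G"

lemma card_shift_set:
  assumes "finite F" "x \<in> F" "a \<notin> F"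
  shows "card (shift_set a x F) = card F"
  using assms by (simp add: shift_set_def) (metis card_Suc_Diff1 One_nat_def card_Diff_singleton)

lemma inj_on_shift_set: "inj_on (shift_set a x) (movable a x G)"
proof (rule inj_onI)
  fix A B assume "A \<in> movable a x G" "B \<in> movable a x G" "shift_set a x A = shift_set a x B"
  then show "A = B" unfolding movable_def shift_set_def
    by (metis (no_types, lifting) Diff_insert_absorb insert_Diff insert_Diff_if mem_Collect_eq
        insertE DiffD1)
qed

lemma sum_shift:
  fixes f :: "'a set \<Rightarrow> 'b::comm_monoid_add"
  assumes "finite G"
  shows "sum f (shift a x G) = sum f (G - movable a x G) + (\<Sum>F\<in>movable a x G. f (shift_set a x F))"
proof -
  have sub: "movable a x G \<subseteq> G" by (auto simp: movable_def)
  then have "finite (movable a x G)" using assms finite_subset by blast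
  then have "sum f (shift a x G) = sum f (G - movable a x G) + sum f (shift_set a x ` movable a x G)"
    unfolding shift_def using assms by (intro sum.union_disjoint) (auto simp: movable_def)
  then show ?thesis by (simp add: sum.reindex[OF inj_on_shift_set])
qed

lemma mu_shift:
  assumes "finite G" "\<And>F. F \<in> G \<Longrightarrow> finite F"
  shows "mu n p (shift a x G) = mu n p G"
proof -
  have "(\<Sum>F\<in>movable a x G. mu_set n p (shift_set a x F)) = sum (mu_set n p) (movable a x G)"
    using assms(2) by (intro sum.cong) (auto simp: mu_set_def movable_def card_shift_set)
  then show ?thesis
    unfolding mu_def sum_shift[OF assms(1)]
    by (metis (no_types, lifting) assms(1) movable_def mem_Collect_eq subsetI sum.subset_diff)
qed

text \<open>The delicate case is a moved set \<open>shift_set a x A\<close> against a set \<open>B\<close> that stays although it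
  contains \<open>x\<close> and not \<open>a\<close>. It stays because \<open>shift_set a x B\<close> is already a member, and that member
  meets \<open>A\<close> exactly where \<open>B\<close> meets \<open>shift_set a x A\<close>.\<close>

lemma card_moved_inter_stationary:
  assumes s: "pairwise_intersecting s G" and fin: "\<And>F. F \<in> G \<Longrightarrow> finite F"
    and A: "A \<in> movable a x G" and B: "B \<in> G" "B \<notin> movable a x G"
  shows "s \<le> card (shift_set a x A \<inter> B)"
proof -
  have AG: "A \<in> G" "x \<in> A" "a \<notin> A" using A by (auto simp: movable_def)
  have AB: "s \<le> card (A \<inter> B)" "finite A" "finite B"
    using s AG B fin unfolding pairwise_intersecting_def by blast+
  consider "x \<notin> B" | "x \<in> B" "a \<in> B" | "x \<in> B" "a \<notin> B" by blast
  then show ?thesis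
  proof cases
    case 1
    then have "A \<inter> B \<subseteq> shift_set a x A \<inter> B" by (auto simp: shift_set_def)
    then have "card (A \<inter> B) \<le> card (shift_set a x A \<inter> B)"
      using AB by (intro card_mono) auto
    then show ?thesis using AB by linarith
  next
    case 2
    then have "shift_set a x A \<inter> B = shift_set a x (A \<inter> B)" using AG by (auto simp: shift_set_def)
    then show ?thesis using 2 AG AB by (simp add: card_shift_set)
  next
    case 3
    then have "shift_set a x B \<in> G" using B by (auto simp: movable_def)
    then have "s \<le> card (A \<inter> shift_set a x B)"
      using s AG unfolding pairwise_intersecting_def by blast
    moreover have "A \<inter> shift_set a x B = shift_set a x A \<inter> B"
      using 3 AG by (auto simp: shift_set_def)
    ultimately show ?thesis by simp
  qed
qed

lemma pairwise_intersecting_shift: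
  assumes s: "pairwise_intersecting s G" and fin: "\<And>F. F \<in> G \<Longrightarrow> finite F"
  shows "pairwise_intersecting s (shift a x G)"
  unfolding pairwise_intersecting_def
proof (intro ballI)
  let ?M = "movable a x G"
  have mixed: "s \<le> card (shift_set a x A \<inter> B)" if "A \<in> ?M" "B \<in> G - ?M" for A B
    using card_moved_inter_stationary[OF s fin] that by blast
  have moved: "s \<le> card (shift_set a x A \<inter> shift_set a x B)" if "A \<in> ?M" "B \<in> ?M" for A B
  proof -
    have AB: "A \<in> G" "B \<in> G" "x \<in> A \<inter> B" "a \<notin> A \<inter> B" using that by (auto simp: movable_def)
    have "shift_set a x A \<inter> shift_set a x B = shift_set a x (A \<inter> B)" by (auto simp: shift_set_def)
    then have "card (shift_set a x A \<inter> shift_set a x B) = card (A \<inter> B)"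
      using AB fin by (simp add: card_shift_set)
    then show ?thesis using s AB unfolding pairwise_intersecting_def by simp
  qed
  fix A B assume "A \<in> shift a x G" "B \<in> shift a x G"
  then consider "A \<in> G" "B \<in> G"
    | A' where "A' \<in> ?M" "A = shift_set a x A'" "B \<in> G - ?M"
    | B' where "B' \<in> ?M" "B = shift_set a x B'" "A \<in> G - ?M"
    | A' B' where "A' \<in> ?M" "B' \<in> ?M" "A = shift_set a x A'" "B = shift_set a x B'"
    unfolding shift_def by blast
  then show "s \<le> card (A \<inter> B)"
  proof cases
    case 1
    then show ?thesis using s unfolding pairwise_intersecting_def by blast
  next
    case 3
    then show ?thesis using mixed[of B' A] by (simp add: Int_commute)
  qed (use mixed moved in auto)
qed

text \<open>Every effective shift towards \<open>a\<close> increases the number of members containing \<open>a\<close>, so a family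
  that maximises this number is stable under all these shifts.\<close>

lemma exists_shifted_family:
  assumes "finite X" "a \<in> X" "G \<subseteq> Pow X" "pairwise_intersecting s G"
  obtains H where "H \<subseteq> Pow X" "pairwise_intersecting s H" "mu n p H = mu n p G"
    "\<And>F x. F \<in> H \<Longrightarrow> x \<in> F \<Longrightarrow> a \<notin> F \<Longrightarrow> shift_set a x F \<in> H"
proof -
  define good where
    "good H \<longleftrightarrow> H \<subseteq> Pow X \<and> pairwise_intersecting s H \<and> mu n p H = mu n p G" for H
  define N where "N H = (\<Sum>F\<in>H. if a \<in> F then 1 else 0 :: nat)" for H
  have "N H < Suc (card (Pow X))" if "good H" for H
  proof -
    have "N H \<le> (\<Sum>F\<in>H. 1)" unfolding N_def by (intro sum_mono) auto
    also have "\<dots> \<le> card (Pow X)"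
      using that assms(1) unfolding good_def by (simp add: card_mono)
    finally show ?thesis by simp
  qed
  moreover have "good G" using assms by (simp add: good_def)
  ultimately obtain H where H: "good H" and max: "\<And>H'. good H' \<Longrightarrow> N H' \<le> N H"
    using ex_has_greatest_nat[of good G N "Suc (card (Pow X))"] by (metis less_imp_le)
  have HX: "H \<subseteq> Pow X" using H by (simp add: good_def)
  have fH: "finite H" "\<And>F. F \<in> H \<Longrightarrow> finite F"
    using HX assms(1) by (meson finite_Pow_iff finite_subset PowD subsetD)+
  have "shift_set a x F \<in> H" if F: "F \<in> H" "x \<in> F" "a \<notin> F" for F x
  proof (rule ccontr)
    assume "shift_set a x F \<notin> H"
    then have FM: "F \<in> movable a x H" using F by (simp add: movable_def)
    have sub: "movable a x H \<subseteq> H" by (auto simp: movable_def)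
    then have fM: "finite (movable a x H)" using fH finite_subset by blast
    have "shift a x H \<subseteq> Pow X"
      using HX assms(2) by (auto simp: shift_def movable_def shift_set_def)
    then have "good (shift a x H)"
      using H pairwise_intersecting_shift[of s H a x] mu_shift[of H n p a x] fH
      by (simp add: good_def)
    then have "N (shift a x H) \<le> N H" by (rule max)
    moreover have "N (shift a x H) = N (H - movable a x H) + card (movable a x H)"
      unfolding N_def sum_shift[OF fH(1)] by (simp add: shift_set_def)
    moreover have "N H = N (H - movable a x H) + N (movable a x H)"
      unfolding N_def using sub fH(1) by (rule sum.subset_diff)
    moreover have "N (movable a x H) = 0" unfolding N_def by (auto simp: movable_def)
    moreover have "0 < card (movable a x H)" using FM fM card_gt_0_iff by blast
    ultimately show False by linarith
  qed
  then show thesis using that[of H] H unfolding good_def by blast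
qed

section \<open>Pairwise s-intersecting families\<close>

lemma pairwise_intersecting_link:
  assumes "pairwise_intersecting (Suc s) G" "\<And>F. F \<in> G \<Longrightarrow> finite F"
  shows "pairwise_intersecting s (link a G)"
  unfolding pairwise_intersecting_def
proof (intro ballI)
  fix A B assume AB: "A \<in> link a G" "B \<in> link a G"
  then have "Suc s \<le> card (insert a A \<inter> insert a B)"
    using assms(1) unfolding pairwise_intersecting_def link_def by blast
  moreover have "finite (A \<inter> B)" "a \<notin> A \<inter> B"
    using AB assms(2)[of "insert a A"] by (auto simp: link_def)
  moreover have "insert a A \<inter> insert a B = insert a (A \<inter> B)" by blast
  ultimately show "s \<le> card (A \<inter> B)" by simp
qed

text \<open>If \<open>x\<close> is a common element of \<open>A\<close> and \<open>B\<close>, then shifting \<open>x\<close> to \<open>a\<close> in \<open>B\<close> alone removes \<open>x\<close>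
  from the intersection and adds nothing to it; the result still has at least \<open>s\<close> elements.\<close>

lemma pairwise_intersecting_deletion:
  assumes s: "pairwise_intersecting s G" "1 \<le> s" and fin: "\<And>F. F \<in> G \<Longrightarrow> finite F"
    and stable: "\<And>F x. F \<in> G \<Longrightarrow> x \<in> F \<Longrightarrow> a \<notin> F \<Longrightarrow> shift_set a x F \<in> G"
  shows "pairwise_intersecting (Suc s) (deletion a G)"
  unfolding pairwise_intersecting_def
proof (intro ballI)
  fix A B assume "A \<in> deletion a G" "B \<in> deletion a G"
  then have AB: "A \<in> G" "B \<in> G" "a \<notin> A" "a \<notin> B" by (auto simp: deletion_def)
  have "1 \<le> card (A \<inter> B)" using s AB unfolding pairwise_intersecting_def by fastforce
  then obtain x where x: "x \<in> A \<inter> B" by (metis card.empty ex_in_conv not_one_le_zero)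
  then have "shift_set a x B \<in> G" using stable AB by blast
  then have "s \<le> card (A \<inter> shift_set a x B)"
    using s(1) AB unfolding pairwise_intersecting_def by blast
  moreover have "A \<inter> shift_set a x B = (A \<inter> B) - {x}" using AB by (auto simp: shift_set_def)
  moreover have "Suc (card ((A \<inter> B) - {x})) = card (A \<inter> B)"
    using x fin[OF AB(1)] by (intro card_Suc_Diff1) auto
  ultimately show "Suc s \<le> card (A \<inter> B)" by (metis Suc_le_mono)
qed

text \<open>With \<open>\<alpha> = p / (1 - p)\<close> the powers of \<open>\<alpha>\<close> are harmonic for the walk, that is,
  \<open>\<alpha> ^ Suc k = p * \<alpha> ^ k + (1 - p) * \<alpha> ^ Suc (Suc k)\<close>; this makes the induction close. The walk
  is stopped at \<open>s = 1\<close>, where the link carries no intersection condition.\<close>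

lemma mu_pairwise_intersecting:
  assumes "finite X" "G \<subseteq> Pow X" "pairwise_intersecting (Suc k) G" "0 < p" "p \<le> 1/2"
  shows "mu (card X) p G \<le> p * (p / (1 - p)) ^ k"
  using assms(1-3)
proof (induction X arbitrary: G k rule: finite_induct)
  case empty
  then have "A \<notin> G" for A unfolding pairwise_intersecting_def by fastforce
  then have "G = {}" by blast
  then show ?case using assms by (simp add: mu_def)
next
  case (insert a X)
  show ?case
  proof (cases k)
    case 0
    then show ?thesis
      using mu_intersecting[of "insert a X" G p] insert assms(4,5) by simp
  next
    case (Suc j)
    let ?\<alpha> = "p / (1 - p)" and ?n = "card X"
    obtain H where H: "H \<subseteq> Pow (insert a X)" "pairwise_intersecting (Suc k) H"
      "mu (card (insert a X)) p H = mu (card (insert a X)) p G"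
      "\<And>F x. F \<in> H \<Longrightarrow> x \<in> F \<Longrightarrow> a \<notin> F \<Longrightarrow> shift_set a x F \<in> H"
      using exists_shifted_family[of "insert a X" a G "Suc k" "card (insert a X)" p] insert
      by (metis finite_insert insertI1)
    have fin: "\<And>F. F \<in> H \<Longrightarrow> finite F"
      using H(1) insert.hyps by (meson finite_insert finite_subset PowD subsetD)
    have link: "mu ?n p (link a H) \<le> p * ?\<alpha> ^ j"
      using H fin Suc pairwise_intersecting_link[of k H a]
      by (intro insert.IH link_subset) auto
    have deletion: "mu ?n p (deletion a H) \<le> p * ?\<alpha> ^ Suc k"
      using H pairwise_intersecting_deletion[OF H(2) _ fin H(4)]
      by (intro insert.IH deletion_subset) auto
    have "mu (card (insert a X)) p G = p * mu ?n p (link a H) + (1 - p) * mu ?n p (deletion a H)"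
      using mu_split[OF insert.hyps H(1)] H(3) by simp
    also have "\<dots> \<le> p * (p * ?\<alpha> ^ j) + (1 - p) * (p * ?\<alpha> ^ Suc k)"
      using link deletion assms(4,5) by (intro add_mono mult_left_mono) auto
    also have "\<dots> = p * ?\<alpha> ^ j * (p + (1 - p) * (?\<alpha> * ?\<alpha>))"
      by (simp add: Suc algebra_simps)
    also have "p + (1 - p) * (?\<alpha> * ?\<alpha>) = ?\<alpha>"
      using assms(4,5) by (simp add: divide_simps) (simp add: algebra_simps)
    finally show ?thesis by (simp add: Suc algebra_simps)
  qed
qed

section \<open>From multiple to pairwise intersections\<close>

lemma wise_intersecting_star_or_Suc:
  assumes "wise_intersecting (Suc k) t G" "1 \<le> k" "\<And>F. F \<in> G \<Longrightarrow> finite F"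
  shows "wise_intersecting k (Suc t) G \<or> (\<exists>T. finite T \<and> card T = t \<and> (\<forall>F\<in>G. T \<subseteq> F))"
proof (cases "wise_intersecting k (Suc t) G")
  case False
  then obtain f where f: "\<forall>i\<in>{1..k}. f i \<in> G" "\<not> Suc t \<le> card (\<Inter>i\<in>{1..k}. f i)"
    unfolding wise_intersecting_def by blast
  define T where "T = (\<Inter>i\<in>{1..k}. f i)"
  have T1: "T \<subseteq> f 1" using assms(2) by (auto simp: T_def)
  have f1: "f 1 \<in> G" using f(1) assms(2) by simp
  then have fT: "finite T" using T1 assms(3) finite_subset by blast
  have meet: "t \<le> card (T \<inter> F)" if "F \<in> G" for F
  proof -
    let ?g = "f(Suc k := F)"
    have "\<forall>i\<in>{1..Suc k}. ?g i \<in> G" using f(1) that by auto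
    then have "t \<le> card (\<Inter>i\<in>{1..Suc k}. ?g i)"
      using assms(1) unfolding wise_intersecting_def by blast
    also have "(\<Inter>i\<in>{1..Suc k}. ?g i) = T \<inter> F"
      unfolding T_def by (auto simp: atLeastAtMostSuc_conv)
    finally show ?thesis .
  qed
  have "card T = t"
    using f(2) meet[OF f1] inf_absorb1[OF T1] unfolding T_def[symmetric] by simp
  moreover have "T \<subseteq> F" if "F \<in> G" for F
    using card_seteq[of T "T \<inter> F"] meet[OF that] fT \<open>card T = t\<close> by auto
  ultimately show ?thesis using fT by blast
qed simp

lemma pairwise_intersecting_of_wise:
  assumes "wise_intersecting 2 s G"
  shows "pairwise_intersecting s G"
  unfolding pairwise_intersecting_def
proof (intro ballI)
  fix A B assume AB: "A \<in> G" "B \<in> G"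
  let ?f = "\<lambda>i :: nat. if i = 1 then A else B"
  have "\<forall>i\<in>{1..2}. ?f i \<in> G" using AB by simp
  then have "s \<le> card (\<Inter>i\<in>{1..2}. ?f i)"
    using assms[unfolded wise_intersecting_def, rule_format, of ?f] by blast
  moreover have "{1..2} = {1, 2 :: nat}" by auto
  ultimately show "s \<le> card (A \<inter> B)" by simp
qed

lemma wise_intersecting_star_or_pairwise:
  assumes "wise_intersecting (m + 2) t G" "\<And>F. F \<in> G \<Longrightarrow> finite F"
  shows "pairwise_intersecting (t + m) G \<or> (\<exists>T. finite T \<and> t \<le> card T \<and> (\<forall>F\<in>G. T \<subseteq> F))"
  using assms(1)
proof (induction m arbitrary: t)
  case 0
  then have "wise_intersecting 2 t G" by (simp only: add_0)
  then show ?case by (simp add: pairwise_intersecting_of_wise)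
next
  case (Suc m)
  then have "wise_intersecting (m + 2) (Suc t) G
      \<or> (\<exists>T. finite T \<and> card T = t \<and> (\<forall>F\<in>G. T \<subseteq> F))"
    using assms(2) by (intro wise_intersecting_star_or_Suc) auto
  then show ?case
  proof
    assume "wise_intersecting (m + 2) (Suc t) G"
    from Suc.IH[OF this] show ?thesis using Suc_leD by auto
  qed auto
qed

section \<open>The measure of multiply intersecting families\<close>

theorem theorem9:
  fixes n t d :: nat and p :: real and \<F> :: "nat set set"
  assumes "t \<ge> 2" and "d \<ge> 3"
    and "\<F> \<subseteq> Pow {1..n}"
    and "wise_intersecting d t \<F>"
    and "0 < p" and "p < beta t d"
  shows "mu n p \<F> \<le> p ^ t"
proof -
  define k where "k = t + d - 3"
  let ?\<beta> = "beta t d"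
  note \<beta> = beta_root[OF assms(1,2)]
  have p: "p < 1/2" using \<beta>(2) assms(6) by linarith
  have fin: "finite F" if "F \<in> \<F>" for F
    using that assms(3) by (meson PowD finite_atLeastAtMost finite_subset subsetD)
  have d: "d - 2 + 2 = d" "t + (d - 2) = Suc k" using assms by (auto simp: k_def)
  have "pairwise_intersecting (Suc k) \<F>
      \<or> (\<exists>T. finite T \<and> t \<le> card T \<and> (\<forall>F\<in>\<F>. T \<subseteq> F))"
    using wise_intersecting_star_or_pairwise[of "d - 2" t \<F>] assms(4) fin unfolding d by blast
  then show ?thesis
  proof
    assume "pairwise_intersecting (Suc k) \<F>"
    then have "mu n p \<F> \<le> p * (p / (1 - p)) ^ k"
      using mu_pairwise_intersecting[of "{1..n}" \<F> k p] assms p by simp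
    also have "\<dots> = p ^ t * (p ^ (d - 2) / (1 - p) ^ k)"
      by (simp add: power_divide d(2) flip: power_Suc power_add)
    also have "\<dots> \<le> p ^ t * 1"
    proof (intro mult_left_mono)
      have "p ^ (d - 2) \<le> ?\<beta> ^ (d - 2)" using assms by (intro power_mono) auto
      also have "\<dots> = (1 - ?\<beta>) ^ k" using \<beta>(3) by (simp add: f_poly_def k_def)
      also have "\<dots> \<le> (1 - p) ^ k" using assms \<beta>(2) by (intro power_mono) auto
      finally show "p ^ (d - 2) / (1 - p) ^ k \<le> 1" using p by (simp add: divide_le_eq_1)
    qed (use assms in simp)
    finally show ?thesis by simp
  next
    assume "\<exists>T. finite T \<and> t \<le> card T \<and> (\<forall>F\<in>\<F>. T \<subseteq> F)"
    then obtain T where T: "finite T" "t \<le> card T" "\<forall>F\<in>\<F>. T \<subseteq> F" by blast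
    have "mu (card {1..n}) p \<F> \<le> p ^ card T"
      by (rule mu_star_le) (use T assms p in auto)
    also have "\<dots> \<le> p ^ t" using T assms p by (intro power_decreasing) auto
    finally show ?thesis by simp
  qed
qed

end
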